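(* Let $V$ be a $\mathbb{C}$-vector space of finite dimension $d$, let $k\ge 1$ be an integer, and let $T\in\mathcal{U}_{k}(V)$ be a nonzero tensor in the universal signature variety. Then $T$ has rank $1$ if and only if $T$ is symmetric.
   Context: $\mathbb{T}((V))=\prod_{k\in\mathbb{N}}V^{\otimes k}$ is the algebra of formal tensor series $\mathcal{T}=\mathcal{T}_{(0)}+\mathcal{T}_{(1)}+\cdots$ with $\mathcal{T}_{(k)}\in V^{\otimes k}$ and multiplication given by the tensor product. $\mathrm{Lie}(V)$ is the smallest vector subspace of $\mathbb{T}((V))$ containing $V$ and closed under the commutator bracket $[a,b]=a\otimes b-b\otimes a$; $\mathrm{Lie}^kV:=\mathrm{Lie}(V)\cap V^{\otimes k}$, and $\mathrm{Lie}((V)):=\prod_{k\ge1}\mathrm{Lie}^kV$ is the space of Lie series. For $\mathcal{T}$ with $\mathcal{T}_{(0)}=0$ put $\exp(\mathcal{T})=\sum_{n\ge0}\mathcal{T}^{\otimes n}/n!$. The universal signature variety $\mathcal{U}_k(V)\subset V^{\otimes k}$ is the image of the map $$\varphi_k:\mathrm{Lie}((V))\to V^{\otimes k},\qquad \mathcal{T}_{(1)}+\mathcal{T}_{(2)}+\cdots\mapsto\sum\frac1{\ell!}\mathcal{T}_{(\alpha_1)}\otimes\cdots\otimes\mathcal{T}_{(\alpha_\ell)},$$ the sum being over all tuples of positive integers $(\alpha_1,\dots,\alpha_\ell)$ with $\alpha_1+\cdots+\alpha_\ell=k$; that is, $\varphi_k(\mathcal{T})$ is the degree-$k$ component of $\exp(\mathcal{T})$.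 Elements of $\mathcal{U}_k(V)$ are called signature tensors. The rank of $T\in V^{\otimes k}$ is the minimal number of elementary tensors $v_1\otimes\cdots\otimes v_k$ ($v_i\in V$) summing to $T$. $T$ is symmetric if it is invariant under all permutations of the $k$ tensor factors. *)

theory Defs
  imports Complex_Main "HOL-Combinatorics.Permutations" "HOL-Library.Function_Algebras"
begin

text \<open>
  The vector space \<open>V\<close> is the type \<open>'v\<close> with scalar multiplication \<open>smul\<close>.
  The tensor \<open>v\<^sub>1 \<otimes> \<dots> \<otimes> v\<^sub>k\<close> is represented by the \<open>k\<close>-linear form
  \<open>(f\<^sub>1, \<dots>, f\<^sub>k) \<mapsto> f\<^sub>1 v\<^sub>1 \<cdots> f\<^sub>k v\<^sub>k\<close> on the dual space; this identifies the \<open>k\<close>-th tensor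
  power of \<open>V\<close> with the linear span of these forms. (For finite-dimensional \<open>V\<close> that span consists
  of all \<open>k\<close>-linear forms on the dual; over a field the identification is injective for every \<open>V\<close>.)

  The argument tuples are lists, and one function on lists of arbitrary length carries all degrees
  at once: its restriction to the lists of length \<open>k\<close> is the component of degree \<open>k\<close>. Such functions
  are made to vanish on lists having an entry that is not a linear functional, so that equality of
  functions is equality of tensor series.
\<close>

type_synonym 'v series = "('v \<Rightarrow> complex) list \<Rightarrow> complex"

definition dual :: "(complex \<Rightarrow> 'v \<Rightarrow> 'v) \<Rightarrow> ('v::ab_group_add \<Rightarrow> complex) set" where
  "dual smul = {f. Vector_Spaces.linear smul (*) f}"

definition scale_series :: "complex \<Rightarrow> 'v series \<Rightarrow> 'v series" where
  "scale_series c S = (\<lambda>fs. c * S fs)"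

interpretation series: vector_space scale_series
  by unfold_locales (auto simp: scale_series_def fun_eq_iff algebra_simps)

definition component :: "nat \<Rightarrow> 'v series \<Rightarrow> 'v series" where
  "component k S = (\<lambda>fs. if length fs = k then S fs else 0)"

definition elementary_tensor ::
    "(complex \<Rightarrow> 'v \<Rightarrow> 'v) \<Rightarrow> 'v::ab_group_add list \<Rightarrow> 'v series" where
  "elementary_tensor smul vs =
     (\<lambda>fs. if length fs = length vs \<and> set fs \<subseteq> dual smul
           then \<Prod>i<length vs. (fs ! i) (vs ! i) else 0)"

definition tensor_power ::
    "(complex \<Rightarrow> 'v \<Rightarrow> 'v) \<Rightarrow> nat \<Rightarrow> 'v::ab_group_add series set" where
  "tensor_power smul k = series.span {elementary_tensor smul vs | vs. length vs = k}"

definition tensor_series :: "(complex \<Rightarrow> 'v \<Rightarrow> 'v) \<Rightarrow> 'v::ab_group_add series set" where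
  "tensor_series smul = {S. \<forall>k. component k S \<in> tensor_power smul k}"

text \<open>
  The tensor product, extended to series: the component of degree \<open>n\<close> of the product is
  the sum over \<open>i \<le> n\<close> of the tensor products of the components of degrees \<open>i\<close> and \<open>n - i\<close>.
\<close>

definition tensor_mult :: "'v series \<Rightarrow> 'v series \<Rightarrow> 'v series" (infixl \<open>\<otimes>\<^sub>t\<close> 70) where
  "S \<otimes>\<^sub>t S' = (\<lambda>fs. \<Sum>i\<le>length fs. S (take i fs) * S' (drop i fs))"

lemma tensor_mult_elementary:
  "elementary_tensor smul vs \<otimes>\<^sub>t elementary_tensor smul ws = elementary_tensor smul (vs @ ws)"
proof
  fix fs :: "('a \<Rightarrow> complex) list"
  have split: "(\<Prod>i<n + m. g i) = (\<Prod>i<n. g i) * (\<Prod>i<m. g (n + i))"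
    for g :: "nat \<Rightarrow> complex" and n m
    by (induction m) (simp_all add: mult.assoc)
  let ?n = "length vs" and ?m = "length ws"
  let ?t = "\<lambda>i. elementary_tensor smul vs (take i fs) * elementary_tensor smul ws (drop i fs)"
  show "(elementary_tensor smul vs \<otimes>\<^sub>t elementary_tensor smul ws) fs
      = elementary_tensor smul (vs @ ws) fs"
  proof (cases "length fs = ?n + ?m")
    case False
    then have "?t i = 0" if "i \<le> length fs" for i
      using that by (auto simp: elementary_tensor_def)
    then have "(\<Sum>i\<le>length fs. ?t i) = 0"
      by (intro sum.neutral) auto
    then show ?thesis using False by (simp add: tensor_mult_def elementary_tensor_def)
  next
    case True
    have "(\<Sum>i\<le>length fs. ?t i) = (\<Sum>i\<in>{?n}. ?t i)"
      using True by (intro sum.mono_neutral_right) (auto simp: elementary_tensor_def)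
    moreover have "set fs = set (take ?n fs) \<union> set (drop ?n fs)"
      by (metis append_take_drop_id set_append)
    moreover have "(\<Prod>i<?n + ?m. (fs ! i) ((vs @ ws) ! i))
        = (\<Prod>i<?n. (fs ! i) (vs ! i)) * (\<Prod>i<?m. (fs ! (?n + i)) (ws ! i))"
      by (simp add: split nth_append)
    ultimately show ?thesis using True
      by (auto simp: tensor_mult_def elementary_tensor_def)
  qed
qed

definition bracket :: "'v series \<Rightarrow> 'v series \<Rightarrow> 'v series" where
  "bracket a b = a \<otimes>\<^sub>t b - b \<otimes>\<^sub>t a"

definition Lie :: "(complex \<Rightarrow> 'v \<Rightarrow> 'v) \<Rightarrow> 'v::ab_group_add series set" where
  "Lie smul =
     \<Inter>{L. series.subspace L \<and> L \<subseteq> tensor_series smul \<and>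
         range (\<lambda>v. elementary_tensor smul [v]) \<subseteq> L \<and>
         (\<forall>a\<in>L. \<forall>b\<in>L. bracket a b \<in> L)}"

definition Lie_deg :: "(complex \<Rightarrow> 'v \<Rightarrow> 'v) \<Rightarrow> nat \<Rightarrow> 'v::ab_group_add series set" where
  "Lie_deg smul k = Lie smul \<inter> tensor_power smul k"

definition Lie_series :: "(complex \<Rightarrow> 'v \<Rightarrow> 'v) \<Rightarrow> 'v::ab_group_add series set" where
  "Lie_series smul =
     {S. component 0 S = 0 \<and> (\<forall>k\<ge>1. component k S \<in> Lie_deg smul k)}"

definition compositions :: "nat \<Rightarrow> nat list set" where
  "compositions k = {\<alpha>. (\<forall>a\<in>set \<alpha>. a \<ge> 1) \<and> sum_list \<alpha> = k}"

lemma finite_compositions: "finite (compositions k)"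
proof (rule finite_subset)
  have "length \<alpha> \<le> sum_list \<alpha>" if "\<forall>a\<in>set \<alpha>. a \<ge> 1" for \<alpha> :: "nat list"
    using that by (induction \<alpha>) auto
  then show "compositions k \<subseteq> {\<alpha>. set \<alpha> \<subseteq> {..k} \<and> length \<alpha> \<le> k}"
    by (auto simp: compositions_def intro: member_le_sum_list)
  show "finite {\<alpha>. set \<alpha> \<subseteq> {..k} \<and> length \<alpha> \<le> k}"
    by (rule finite_lists_length_le) simp
qed

text \<open>The empty product below is the unit \<open>elementary_tensor smul []\<close> of the tensor algebra.\<close>

definition sig_map ::
    "(complex \<Rightarrow> 'v \<Rightarrow> 'v) \<Rightarrow> nat \<Rightarrow> 'v::ab_group_add series \<Rightarrow> 'v series" where
  "sig_map smul k S =
     (\<Sum>\<alpha>\<in>compositions k. scale_series (1 / fact (length \<alpha>))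
        (foldr (\<otimes>\<^sub>t) (map (\<lambda>a. component a S) \<alpha>) (elementary_tensor smul [])))"

definition signature_variety ::
    "(complex \<Rightarrow> 'v \<Rightarrow> 'v) \<Rightarrow> nat \<Rightarrow> 'v::ab_group_add series set" where
  "signature_variety smul k = sig_map smul k ` Lie_series smul"

definition tensor_rank ::
    "(complex \<Rightarrow> 'v \<Rightarrow> 'v) \<Rightarrow> nat \<Rightarrow> 'v::ab_group_add series \<Rightarrow> nat" where
  "tensor_rank smul k T =
     (LEAST r. \<exists>vss. length vss = r \<and> (\<forall>vs\<in>set vss. length vs = k) \<and>
        T = sum_list (map (elementary_tensor smul) vss))"

text \<open>
  On forms, permuting the tensor factors is permuting the arguments; see the lemma
  \<open>permute_tensor_elementary\<close> for the effect on elementary tensors.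
\<close>

definition permute_tensor :: "(nat \<Rightarrow> nat) \<Rightarrow> 'v series \<Rightarrow> 'v series" where
  "permute_tensor \<pi> T = (\<lambda>fs. T (permute_list \<pi> fs))"

lemma permute_tensor_elementary:
  assumes \<pi>: "\<pi> permutes {..<length vs}"
  shows "permute_tensor \<pi> (elementary_tensor smul vs)
    = elementary_tensor smul (permute_list (inv \<pi>) vs)"
proof
  fix fs :: "('a \<Rightarrow> complex) list"
  show "permute_tensor \<pi> (elementary_tensor smul vs) fs
      = elementary_tensor smul (permute_list (inv \<pi>) vs) fs"
  proof (cases "length fs = length vs")
    case True
    have "(\<Prod>i<length vs. (fs ! \<pi> i) (vs ! i))
        = (\<Prod>i<length vs. (fs ! i) (vs ! inv \<pi> i))"
      by (subst prod.permute[OF \<pi>, of "\<lambda>i. (fs ! i) (vs ! inv \<pi> i)"])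
         (simp add: o_def permutes_inverses[OF \<pi>])
    then show ?thesis using True \<pi> permutes_inv[OF \<pi>]
      by (simp add: permute_tensor_def elementary_tensor_def permute_list_nth)
  qed (simp add: permute_tensor_def elementary_tensor_def)
qed

definition symmetric_tensor :: "nat \<Rightarrow> 'v series \<Rightarrow> bool" where
  "symmetric_tensor k T \<longleftrightarrow> (\<forall>\<pi>. \<pi> permutes {..<k} \<longrightarrow> permute_tensor \<pi> T = T)"

end

theory Submission
  imports Defs "HOL-Library.FuncSet"
begin

text \<open>
  Brackets vanish on the diagonal arguments \<open>(f, \<dots>, f)\<close>, so if \<open>v\<close> is the degree-one part of the
  Lie series, then the signature tensor \<open>T\<close> satisfies \<open>T (f, \<dots>, f) = f(v)^k / k!\<close>. A symmetric
  tensor is determined by its diagonal values (polarization), hence a symmetric \<open>T\<close> is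
  \<open>v^{\<otimes>k} / k!\<close>. If \<open>T = v\<^sub>1 \<otimes> \<dots> \<otimes> v\<^sub>k\<close> is nonzero, then \<open>f(v\<^sub>1) \<cdots> f(v\<^sub>k) = f(v)^k / k!\<close> for
  all \<open>f\<close>; a functional vanishing on no \<open>v\<^sub>i\<close> shows \<open>v \<noteq> 0\<close>, and a functional vanishing on \<open>v\<^sub>i\<close> but
  not on \<open>v\<close> cannot exist, so every \<open>v\<^sub>i\<close> is a multiple of \<open>v\<close>.
\<close>

section \<open>Tensor powers\<close>

lemma elementary_tensor_in_tensor_power:
  "length vs = k \<Longrightarrow> elementary_tensor smul vs \<in> tensor_power smul k"
  unfolding tensor_power_def by (rule series.span_base) blast

lemma subspace_tensor_power: "series.subspace (tensor_power smul k)"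
  unfolding tensor_power_def by (rule series.subspace_span)

text \<open>Linear induction: a property that cuts out a subspace needs checking on elementary
  tensors only.\<close>

lemma tensor_power_subset:
  assumes "series.subspace L"
    and "\<And>vs. length vs = k \<Longrightarrow> elementary_tensor smul vs \<in> L"
  shows "tensor_power smul k \<subseteq> L"
  unfolding tensor_power_def by (rule series.span_minimal) (use assms in auto)

text \<open>The default value 0 survives linear combinations, so tensors of degree \<open>k\<close>
  need comparing only on lists of \<open>k\<close> functionals.\<close>

lemma tensor_power_eq_0:
  assumes "S \<in> tensor_power smul k" and "\<not> (length fs = k \<and> set fs \<subseteq> dual smul)"
  shows "S fs = 0"
proof -
  have "tensor_power smul k \<subseteq> {S. S fs = 0}"
    by (rule tensor_power_subset)
      (use assms(2) in \<open>auto simp: series.subspace_def scale_series_def elementary_tensor_def\<close>)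
  then show ?thesis using assms(1) by blast
qed

section \<open>Tensor products and the grading\<close>

lemma tensor_mult_bilinear:
  "(S + S') \<otimes>\<^sub>t U = S \<otimes>\<^sub>t U + S' \<otimes>\<^sub>t U"
  "U \<otimes>\<^sub>t (S + S') = U \<otimes>\<^sub>t S + U \<otimes>\<^sub>t S'"
  "scale_series c S \<otimes>\<^sub>t U = scale_series c (S \<otimes>\<^sub>t U)"
  "U \<otimes>\<^sub>t scale_series c S = scale_series c (U \<otimes>\<^sub>t S)"
  "0 \<otimes>\<^sub>t U = 0" "U \<otimes>\<^sub>t 0 = 0"
  by (auto simp: tensor_mult_def scale_series_def fun_eq_iff algebra_simps sum.distrib sum_distrib_left)

lemma tensor_mult_in_tensor_power:
  assumes "S \<in> tensor_power smul i" and "S' \<in> tensor_power smul j"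
  shows "S \<otimes>\<^sub>t S' \<in> tensor_power smul (i + j)"
proof -
  note sub = subspace_tensor_power[of smul "i + j", unfolded series.subspace_def]
  \<comment> \<open>Bilinear extension, one factor at a time: the left factor stays elementary until
    the right one is arbitrary.\<close>
  have elem: "tensor_power smul j \<subseteq> {S'. elementary_tensor smul vs \<otimes>\<^sub>t S' \<in> tensor_power smul (i + j)}"
    if "length vs = i" for vs
    by (rule tensor_power_subset)
      (use that sub in \<open>auto simp: series.subspace_def tensor_mult_bilinear tensor_mult_elementary
        intro!: elementary_tensor_in_tensor_power\<close>)
  have "tensor_power smul i \<subseteq> {S. S \<otimes>\<^sub>t S' \<in> tensor_power smul (i + j)}"
    by (rule tensor_power_subset)
      (use elem assms(2) sub in \<open>auto simp: series.subspace_def tensor_mult_bilinear\<close>)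
  then show ?thesis using assms(1) by blast
qed

lemma component_tensor_mult:
  "component k (S \<otimes>\<^sub>t S') = (\<Sum>i\<le>k. component i S \<otimes>\<^sub>t component (k - i) S')"
proof
  fix fs :: "('a \<Rightarrow> complex) list"
  have apply_sum: "(\<Sum>i\<in>I. F i) fs = (\<Sum>i\<in>I. F i fs)" for F :: "nat \<Rightarrow> 'a series" and I
    by (induction I rule: infinite_finite_induct) auto
  \<comment> \<open>The two components force lengths \<open>i\<close> and \<open>k - i\<close>, so
    at most the cut after \<open>i\<close> entries contributes, and only on lists of length
    \<open>k\<close>.\<close>
  have inner: "(component i S \<otimes>\<^sub>t component (k - i) S') fs
      = (if length fs = k then S (take i fs) * S' (drop i fs) else 0)" if "i \<le> k" for i
  proof -
    have "(component i S \<otimes>\<^sub>t component (k - i) S') fs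
        = (\<Sum>j\<le>length fs. if j = i
            then (if length fs = k then S (take i fs) * S' (drop i fs) else 0) else 0)"
      unfolding tensor_mult_def
      by (rule sum.cong) (use that in \<open>auto simp: component_def\<close>)
    then show ?thesis using that by simp
  qed
  show "component k (S \<otimes>\<^sub>t S') fs = (\<Sum>i\<le>k. component i S \<otimes>\<^sub>t component (k - i) S') fs"
    by (simp add: apply_sum inner) (simp add: component_def tensor_mult_def)
qed

lemma component_linear:
  "component k (S + S') = component k S + component k S'"
  "component k (scale_series c S) = scale_series c (component k S)"
  "component k 0 = 0"
  by (auto simp: component_def scale_series_def fun_eq_iff)

lemma tensor_mult_in_tensor_series:
  assumes "S \<in> tensor_series smul" and "S' \<in> tensor_series smul"
  shows "S \<otimes>\<^sub>t S' \<in> tensor_series smul"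
  unfolding tensor_series_def
proof safe
  fix k
  have "component i S \<otimes>\<^sub>t component (k - i) S' \<in> tensor_power smul k" if "i \<le> k" for i
    using tensor_mult_in_tensor_power[of "component i S" smul i "component (k - i) S'" "k - i"]
      assms that by (simp add: tensor_series_def)
  then show "component k (S \<otimes>\<^sub>t S') \<in> tensor_power smul k"
    unfolding component_tensor_mult by (intro series.subspace_sum subspace_tensor_power) auto
qed

lemma subspace_tensor_series: "series.subspace (tensor_series smul)"
  using subspace_tensor_power[of smul]
  by (auto simp: series.subspace_def tensor_series_def component_linear)

lemma elementary_tensor_in_tensor_series: "elementary_tensor smul vs \<in> tensor_series smul"
proof -
  have "component k (elementary_tensor smul vs)
      = (if k = length vs then elementary_tensor smul vs else 0)" for k
    by (auto simp: component_def elementary_tensor_def fun_eq_iff)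
  then show ?thesis using subspace_tensor_power[of smul]
    by (auto simp: tensor_series_def series.subspace_def intro: elementary_tensor_in_tensor_power)
qed

section \<open>Sums of elementary tensors and rank one\<close>

lemma scale_elementary_tensor:
  assumes "vector_space smul"
  shows "scale_series c (elementary_tensor smul (v # vs)) = elementary_tensor smul (smul c v # vs)"
proof -
  have "f (smul c v) = c * f v" if "f \<in> dual smul" for f
    using that by (simp add: dual_def Vector_Spaces.linear_iff)
  then show ?thesis
    by (auto simp: scale_series_def elementary_tensor_def fun_eq_iff prod.lessThan_Suc_shift
      length_Suc_conv simp del: prod.lessThan_Suc)
qed

text \<open>Functionals are additive, so in degree one a sum of elementary tensors is again
  elementary. This turns the degree-one part of a Lie series into a vector.\<close>

lemma tensor_power_one:
  assumes vs: "vector_space smul" and "S \<in> tensor_power smul 1"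
  obtains v where "S = elementary_tensor smul [v]"
proof -
  have add: "f (x + y) = f x + f y" if "f \<in> dual smul" for f x y
    using that by (simp add: dual_def Vector_Spaces.linear_iff)
  have zero: "f 0 = 0" if "f \<in> dual smul" for f
    using add[OF that, of 0 0] by simp
  have "series.subspace (range (\<lambda>v. elementary_tensor smul [v]))"
    unfolding series.subspace_def
  proof safe
    show "0 \<in> range (\<lambda>v. elementary_tensor smul [v])"
      by (rule range_eqI[of _ _ 0]) (auto simp: fun_eq_iff elementary_tensor_def zero length_Suc_conv)
  next
    fix x y
    show "elementary_tensor smul [x] + elementary_tensor smul [y]
        \<in> range (\<lambda>v. elementary_tensor smul [v])"
      by (rule range_eqI[of _ _ "x + y"])
        (auto simp: fun_eq_iff elementary_tensor_def add length_Suc_conv)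
  qed (simp add: scale_elementary_tensor[OF vs])
  then have "tensor_power smul 1 \<subseteq> range (\<lambda>v. elementary_tensor smul [v])"
    by (rule tensor_power_subset) (auto simp: length_Suc_conv)
  then show ?thesis using assms(2) that by blast
qed

text \<open>Coefficients of a linear combination are absorbed into the first tensor factors, which
  exist because \<open>k \<ge> 1\<close>. Hence \<open>tensor_rank\<close> is the minimum of a
  nonempty set.\<close>

lemma tensor_power_decomposition:
  assumes vs: "vector_space smul" and "k \<ge> 1" and "T \<in> tensor_power smul k"
  obtains vss where "\<forall>vs\<in>set vss. length vs = k"
    and "T = sum_list (map (elementary_tensor smul) vss)"
proof -
  have "\<exists>vss. (\<forall>vs\<in>set vss. length vs = k) \<and> T = sum_list (map (elementary_tensor smul) vss)"
    using assms(3) unfolding tensor_power_def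
  proof (induction rule: series.span_induct_alt)
    case base
    show ?case by (rule exI[of _ "[]"]) simp
  next
    case (step c x y)
    obtain vs vss where x: "x = elementary_tensor smul vs" "length vs = k"
      and y: "\<forall>vs\<in>set vss. length vs = k" "y = sum_list (map (elementary_tensor smul) vss)"
      using step by blast
    obtain w ws where "vs = w # ws" using x(2) assms(2) by (cases vs) auto
    then show ?case using x y
      by (intro exI[of _ "(smul c w # ws) # vss"]) (simp add: scale_elementary_tensor[OF vs])
  qed
  then show ?thesis using that by blast
qed

lemma tensor_rank_eq_1_iff:
  assumes "vector_space smul" and "k \<ge> 1" and "T \<in> tensor_power smul k" and "T \<noteq> 0"
  shows "tensor_rank smul k T = 1 \<longleftrightarrow> (\<exists>vs. length vs = k \<and> T = elementary_tensor smul vs)"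
proof -
  let ?P = "\<lambda>r. \<exists>vss. length vss = r \<and> (\<forall>vs\<in>set vss. length vs = k) \<and>
        T = sum_list (map (elementary_tensor smul) vss)"
  have one: "?P 1 \<longleftrightarrow> (\<exists>vs. length vs = k \<and> T = elementary_tensor smul vs)"
  proof
    assume "?P 1"
    then show "\<exists>vs. length vs = k \<and> T = elementary_tensor smul vs"
      by (auto simp: length_Suc_conv)
  next
    assume "\<exists>vs. length vs = k \<and> T = elementary_tensor smul vs"
    then obtain vs where "length vs = k" "T = elementary_tensor smul vs" by blast
    then show "?P 1" by (intro exI[of _ "[vs]"]) simp
  qed
  have "\<exists>r. ?P r" using tensor_power_decomposition[OF assms(1-3)] by metis
  then have least: "?P (tensor_rank smul k T)"
    unfolding tensor_rank_def by (rule LeastI_ex)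
  \<comment> \<open>Rank 0 would make \<open>T\<close> the empty sum.\<close>
  then have "tensor_rank smul k T \<noteq> 0" using assms(4) by auto
  moreover have "tensor_rank smul k T \<le> 1" if "?P 1"
    unfolding tensor_rank_def using that by (rule Least_le)
  ultimately have "tensor_rank smul k T = 1 \<longleftrightarrow> ?P 1" using least
    by (metis le_neq_implies_less less_one)
  then show ?thesis using one by blast
qed

section \<open>Diagonal values of signature tensors\<close>

text \<open>Cutting a list of equal entries leaves only two lengths to record, so on such lists the
  tensor product is the Cauchy product of scalar sequences, which commutes.\<close>

lemma bracket_replicate: "bracket a b (replicate n f) = 0"
proof -
  have "(\<Sum>i\<le>n. b (replicate i f) * a (replicate (n - i) f))
      = (\<Sum>i\<le>n. b (replicate (n - i) f) * a (replicate i f))"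
    by (rule sum.reindex_bij_witness[of _ "\<lambda>i. n - i" "\<lambda>i. n - i"]) auto
  moreover have "(S \<otimes>\<^sub>t S') (replicate n f) = (\<Sum>i\<le>n. S (replicate i f) * S' (replicate (n - i) f))"
    for S S' :: "'a series"
    by (auto simp: tensor_mult_def min_def intro!: sum.cong)
  ultimately show ?thesis
    by (simp add: bracket_def mult.commute)
qed

text \<open>By minimality of \<open>Lie smul\<close>: the tensor series vanishing on this list form
  one of the intersected subspaces. It contains the vectors because \<open>n \<noteq> 1\<close>, and
  all brackets of its elements by \<open>bracket_replicate\<close>.\<close>

lemma Lie_replicate_eq_0:
  assumes "S \<in> Lie smul" and "n \<noteq> 1"
  shows "S (replicate n f) = 0"
proof -
  let ?L = "{S \<in> tensor_series smul. S (replicate n f) = 0}"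
  have "series.subspace ?L"
    using subspace_tensor_series[of smul]
    by (auto simp: series.subspace_def scale_series_def)
  moreover have "bracket a b \<in> ?L" if "a \<in> ?L" "b \<in> ?L" for a b
    using that series.subspace_diff[OF subspace_tensor_series[of smul]]
    by (auto simp: bracket_replicate) (simp add: bracket_def tensor_mult_in_tensor_series)
  moreover have "range (\<lambda>v. elementary_tensor smul [v]) \<subseteq> ?L"
    using assms(2) by (auto simp: elementary_tensor_in_tensor_series) (simp add: elementary_tensor_def)
  ultimately have "Lie smul \<subseteq> ?L"
    unfolding Lie_def by (intro Inter_lower) auto
  then show ?thesis using assms(1) by blast
qed

lemma foldr_tensor_mult_in_tensor_power:
  assumes "S \<in> Lie_series smul" and "\<forall>a\<in>set \<alpha>. a \<ge> 1"
  shows "foldr (\<otimes>\<^sub>t) (map (\<lambda>a. component a S) \<alpha>) (elementary_tensor smul [])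
    \<in> tensor_power smul (sum_list \<alpha>)"
  using assms
  by (induction \<alpha>)
    (auto simp: elementary_tensor_in_tensor_power Lie_series_def Lie_deg_def
      intro!: tensor_mult_in_tensor_power)

lemma signature_variety_subset: "signature_variety smul k \<subseteq> tensor_power smul k"
proof -
  have "sig_map smul k S \<in> tensor_power smul k" if "S \<in> Lie_series smul" for S
    unfolding sig_map_def
    by (intro series.subspace_sum series.subspace_scale subspace_tensor_power)
      (use foldr_tensor_mult_in_tensor_power[OF that] in \<open>auto simp: compositions_def\<close>)
  then show ?thesis by (auto simp: signature_variety_def)
qed

text \<open>Only the cut after \<open>a\<close> entries contributes, since
  \<open>component a S\<close> vanishes on every other length.\<close>

lemma component_tensor_mult_replicate:
  "(component a S \<otimes>\<^sub>t U) (replicate (a + n) f) = S (replicate a f) * U (replicate n f)"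
proof -
  have "(component a S \<otimes>\<^sub>t U) (replicate (a + n) f)
      = (\<Sum>i\<le>a + n. if i = a then S (replicate a f) * U (replicate n f) else 0)"
    unfolding tensor_mult_def
    by (rule sum.cong) (auto simp: component_def min_def)
  then show ?thesis by simp
qed

lemma foldr_tensor_mult_replicate:
  "foldr (\<otimes>\<^sub>t) (map (\<lambda>a. component a S) \<alpha>) (elementary_tensor smul [])
      (replicate (sum_list \<alpha>) f) = (\<Prod>a\<leftarrow>\<alpha>. S (replicate a f))"
  by (induction \<alpha>) (simp_all add: component_tensor_mult_replicate elementary_tensor_def)

lemma sig_map_replicate:
  assumes S: "S \<in> Lie_series smul"
  shows "sig_map smul k S (replicate k f) = S [f] ^ k / fact k"
proof -
  have apply_sum: "(\<Sum>i\<in>I. F i) fs = (\<Sum>i\<in>I. F i fs)" for F :: "nat list \<Rightarrow> 'a series" and I fs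
    by (induction I rule: infinite_finite_induct) auto
  have S0: "S (replicate a f) = 0" if "a > 1" for a
  proof -
    have "component a S \<in> Lie smul"
      using S that by (auto simp: Lie_series_def Lie_deg_def)
    then have "component a S (replicate a f) = 0"
      using that by (intro Lie_replicate_eq_0) auto
    then show ?thesis by (simp add: component_def)
  qed
  \<comment> \<open>A part larger than 1 contributes a factor 0, so only the composition
    \<open>1 + ... + 1\<close> survives. It has \<open>k\<close> parts, whence the coefficient
    \<open>1 / fact k\<close>.\<close>
  have ones: "(\<Prod>a\<leftarrow>\<alpha>. S (replicate a f)) = (if \<alpha> = replicate k 1 then S [f] ^ k else 0)"
    if "\<alpha> \<in> compositions k" for \<alpha>
  proof (cases "\<exists>a\<in>set \<alpha>. a > 1")
    case True
    then have "(\<Prod>a\<leftarrow>\<alpha>. S (replicate a f)) = 0"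
      using S0 by (force simp: prod_list_zero_iff)
    then show ?thesis using True by auto
  next
    case False
    then have "\<forall>a\<in>set \<alpha>. a = 1" using that by (force simp: compositions_def)
    then have "\<alpha> = replicate (length \<alpha>) 1"
      by (metis replicate_length_same)
    moreover from this have "length \<alpha> = k"
      using that by (metis (mono_tags, lifting) compositions_def mem_Collect_eq mult.right_neutral
          sum_list_replicate of_nat_id)
    ultimately have "\<alpha> = replicate k 1" by simp
    then show ?thesis by (simp add: prod_list_replicate)
  qed
  have mem: "replicate k 1 \<in> compositions k"
    by (auto simp: compositions_def sum_list_replicate)
  have "sig_map smul k S (replicate k f)
      = (\<Sum>\<alpha>\<in>compositions k. 1 / fact (length \<alpha>) * (\<Prod>a\<leftarrow>\<alpha>. S (replicate a f)))"
    unfolding sig_map_def apply_sum scale_series_def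
    by (rule sum.cong) (auto simp: compositions_def foldr_tensor_mult_replicate)
  also have "\<dots> = (\<Sum>\<alpha>\<in>compositions k. if \<alpha> = replicate k 1 then S [f] ^ k / fact k else 0)"
    by (rule sum.cong) (auto simp: ones)
  also have "\<dots> = S [f] ^ k / fact k"
    using mem finite_compositions by simp
  finally show ?thesis .
qed

text \<open>The vector \<open>v\<close> is the degree-one component of the Lie series; the higher
  components are invisible on the diagonal.\<close>

lemma signature_variety_diagonal:
  assumes "vector_space smul" and "T \<in> signature_variety smul k"
  obtains v where "\<And>f. f \<in> dual smul \<Longrightarrow> T (replicate k f) = f v ^ k / fact k"
proof -
  obtain S where S: "S \<in> Lie_series smul" "T = sig_map smul k S"
    using assms(2) by (auto simp: signature_variety_def)
  then have "component 1 S \<in> tensor_power smul 1"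
    by (auto simp: Lie_series_def Lie_deg_def)
  then obtain v where v: "component 1 S = elementary_tensor smul [v]"
    using tensor_power_one[OF assms(1)] by blast
  have "S [f] = f v" if "f \<in> dual smul" for f
    using fun_cong[OF v, of "[f]"] that by (simp add: component_def elementary_tensor_def)
  then show ?thesis using that[of v] sig_map_replicate[OF S(1)] S(2) by simp
qed

section \<open>Polarization\<close>

text \<open>Complements in \<open>I\<close> range over the subsets of \<open>I - J\<close>, and the
  sum becomes the expansion of \<open>(- 1 + 1) ^ card (I - J)\<close>.\<close>

lemma alternating_sum_supersets:
  assumes "finite I" and "J \<subseteq> I"
  shows "(\<Sum>A | J \<subseteq> A \<and> A \<subseteq> I. (- 1) ^ card (I - A)) = (if J = I then 1 else 0 :: complex)"
proof -
  have "(\<Sum>A | J \<subseteq> A \<and> A \<subseteq> I. (- 1) ^ card (I - A)) = (\<Sum>C\<in>Pow (I - J). (- 1 :: complex) ^ card C)"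
    by (rule sum.reindex_bij_witness[of _ "\<lambda>C. I - C" "\<lambda>A. I - A"])
      (use assms in \<open>auto simp: double_diff\<close>)
  also have "\<dots> = (if J = I then 1 else 0)"
    using prod_add[of "I - J" "\<lambda>_. - 1" "\<lambda>_. 1 :: complex"] assms
    by (auto simp: power_0_left card_eq_0_iff split: if_splits)
  finally show ?thesis .
qed

text \<open>Ryser's formula for the permanent of the matrix \<open>c\<close>: inclusion-exclusion
  over the image singles out the surjections among all maps from \<open>{..<k}\<close> to
  itself.\<close>

lemma Ryser_formula:
  fixes c :: "nat \<Rightarrow> nat \<Rightarrow> complex"
  shows "(\<Sum>A\<in>Pow {..<k}. (- 1) ^ card ({..<k} - A) * (\<Prod>i<k. \<Sum>a\<in>A. c a i))
    = (\<Sum>\<pi> | \<pi> permutes {..<k}. \<Prod>i<k. c (\<pi> i) i)"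
proof -
  let ?I = "{..<k}" and ?F = "PiE {..<k} (\<lambda>_. {..<k})"
  let ?p = "\<lambda>g. \<Prod>i<k. c (g i) i"
  have fin: "finite ?F" by (intro finite_PiE) auto
  \<comment> \<open>Multiplying out gives one term per map into \<open>A\<close>. Putting the
    restriction on the image into a condition frees the index set from \<open>A\<close>, so that the
    sums can be swapped.\<close>
  have "(\<Sum>A\<in>Pow ?I. (- 1) ^ card (?I - A) * (\<Prod>i<k. \<Sum>a\<in>A. c a i))
      = (\<Sum>A\<in>Pow ?I. \<Sum>g\<in>?F. if g ` ?I \<subseteq> A then (- 1) ^ card (?I - A) * ?p g else 0)"
  proof (rule sum.cong)
    fix A assume A: "A \<in> Pow ?I"
    then have "finite A" by (auto intro: finite_subset)
    then have "(\<Prod>i<k. \<Sum>a\<in>A. c a i) = (\<Sum>g\<in>PiE ?I (\<lambda>_. A). ?p g)"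
      by (subst prod_sum_PiE) auto
    also have "\<dots> = (\<Sum>g\<in>?F. if g ` ?I \<subseteq> A then ?p g else 0)"
      unfolding sum.inter_filter[OF fin, symmetric]
      by (rule sum.cong) (use A in \<open>auto simp: PiE_iff extensional_def\<close>)
    finally show "(- 1) ^ card (?I - A) * (\<Prod>i<k. \<Sum>a\<in>A. c a i)
        = (\<Sum>g\<in>?F. if g ` ?I \<subseteq> A then (- 1) ^ card (?I - A) * ?p g else 0)"
      by (simp add: sum_distrib_left if_distrib cong: if_cong)
  qed simp
  also have "\<dots> = (\<Sum>g\<in>?F. (\<Sum>A | g ` ?I \<subseteq> A \<and> A \<subseteq> ?I. (- 1) ^ card (?I - A)) * ?p g)"
    by (subst sum.swap)
      (auto simp: sum.inter_filter[symmetric] sum_distrib_right Pow_def conj_commute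
        intro!: sum.cong)
  also have "\<dots> = (\<Sum>g\<in>?F. if g ` ?I = ?I then ?p g else 0)"
    by (rule sum.cong[OF refl], subst alternating_sum_supersets) (auto simp: PiE_iff)
  also have "\<dots> = (\<Sum>g | g \<in> ?F \<and> g ` ?I = ?I. ?p g)"
    by (simp add: sum.inter_filter[OF fin, symmetric])
  \<comment> \<open>Surjections of the finite set \<open>?I\<close> are bijections. Members of
    \<open>?F\<close> are \<open>undefined\<close> off \<open>?I\<close> while permutations are the
    identity there; the witnesses translate between the two conventions.\<close>
  also have "\<dots> = (\<Sum>\<pi> | \<pi> permutes ?I. ?p \<pi>)"
  proof (rule sum.reindex_bij_witness[of _ "\<lambda>\<pi>. restrict \<pi> ?I" "\<lambda>g i. if i < k then g i else i"])
    fix g assume g: "g \<in> {g. g \<in> ?F \<and> g ` ?I = ?I}"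
    then have "bij_betw g ?I ?I"
      by (simp add: bij_betw_def finite_surj_inj)
    then have bij: "bij_betw (\<lambda>i. if i < k then g i else i) ?I ?I"
      by (rule iffD1[OF bij_betw_cong, rotated]) simp
    have "(\<lambda>i. if i < k then g i else i) permutes ?I"
      by (rule bij_imp_permutes[OF bij]) simp
    then show "(\<lambda>i. if i < k then g i else i) \<in> {\<pi>. \<pi> permutes ?I}"
      by simp
    show "restrict (\<lambda>i. if i < k then g i else i) ?I = g"
      using g by (auto simp: fun_eq_iff PiE_iff extensional_def)
  next
    fix \<pi> assume "\<pi> \<in> {\<pi>. \<pi> permutes ?I}"
    then have \<pi>: "\<pi> permutes ?I" by simp
    show "restrict \<pi> ?I \<in> {g. g \<in> ?F \<and> g ` ?I = ?I}"
      using permutes_image[OF \<pi>] permutes_in_image[OF \<pi>] by auto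
    show "(\<lambda>i. if i < k then restrict \<pi> ?I i else i) = \<pi>"
      using permutes_not_in[OF \<pi>] by (auto simp: fun_eq_iff)
  qed auto
  finally show ?thesis .
qed

lemma dual_sum:
  assumes "vector_space smul" and "\<And>a. a \<in> A \<Longrightarrow> f a \<in> dual smul"
  shows "(\<lambda>x. \<Sum>a\<in>A. f a x) \<in> dual smul"
proof -
  interpret V: vector_space smul by (rule assms(1))
  have "vector_space_pair smul ((*) :: complex \<Rightarrow> _)" by unfold_locales (auto simp: algebra_simps)
  then show ?thesis
    using assms(2) vector_space_pair.linear_compose_sum[of smul "(*)" A f]
    by (auto simp: dual_def)
qed

text \<open>Both sides are linear in \<open>T\<close>, and on an elementary tensor the identity is
  Ryser's formula for the matrix with entries \<open>(fs ! a) (ws ! i)\<close>.\<close>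

lemma polarization:
  assumes vs: "vector_space smul" and "T \<in> tensor_power smul k"
    and fs: "length fs = k" "set fs \<subseteq> dual smul"
  shows "(\<Sum>A\<in>Pow {..<k}. (- 1) ^ card ({..<k} - A) * T (replicate k (\<lambda>x. \<Sum>a\<in>A. (fs ! a) x)))
    = (\<Sum>\<pi> | \<pi> permutes {..<k}. T (permute_list \<pi> fs))"
    (is "?l T = ?r T")
proof -
  have dual: "(\<lambda>x. \<Sum>a\<in>A. (fs ! a) x) \<in> dual smul" if "A \<subseteq> {..<k}" for A
    by (rule dual_sum[OF vs]) (use that fs in \<open>auto intro!: subsetD[OF fs(2)]\<close>)
  have elem: "?l (elementary_tensor smul ws) = ?r (elementary_tensor smul ws)" if "length ws = k" for ws
  proof -
    have "?l (elementary_tensor smul ws) = (\<Sum>A\<in>Pow {..<k}. (- 1) ^ card ({..<k} - A) *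
        (\<Prod>i<k. \<Sum>a\<in>A. (fs ! a) (ws ! i)))"
      by (rule sum.cong) (use that dual in \<open>auto simp: elementary_tensor_def intro!: prod.cong\<close>)
    also have "\<dots> = ?r (elementary_tensor smul ws)"
      unfolding Ryser_formula
      by (rule sum.cong) (use that fs in \<open>auto simp: elementary_tensor_def permute_list_nth\<close>)
    finally show ?thesis .
  qed
  have "tensor_power smul k \<subseteq> {T. ?l T = ?r T}"
  proof (rule tensor_power_subset)
    show "series.subspace {T. ?l T = ?r T}"
      unfolding series.subspace_def scale_series_def
      by (auto simp: sum.distrib distrib_left sum_distrib_left[symmetric] mult.left_commute)
  qed (use elem in auto)
  then show ?thesis using assms(2) by blast
qed

text \<open>For symmetric \<open>T\<close> the \<open>fact k\<close> terms on the right of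
  \<open>polarization\<close> all equal \<open>T fs\<close>, while the left side consists of
  diagonal values. In characteristic 0 the factor \<open>fact k\<close> cancels.\<close>

lemma symmetric_tensor_eq_0:
  assumes vs: "vector_space smul" and T: "T \<in> tensor_power smul k" and sym: "symmetric_tensor k T"
    and diag: "\<And>f. f \<in> dual smul \<Longrightarrow> T (replicate k f) = 0"
  shows "T = 0"
proof
  fix fs
  show "T fs = 0 fs"
  proof (cases "length fs = k \<and> set fs \<subseteq> dual smul")
    case False
    then show ?thesis using tensor_power_eq_0[OF T] by simp
  next
    case True
    have "(\<Sum>\<pi> | \<pi> permutes {..<k}. T (permute_list \<pi> fs)) = 0"
      unfolding polarization[OF vs T conjunct1[OF True] conjunct2[OF True], symmetric]
      by (intro sum.neutral) (use True in \<open>auto intro!: diag dual_sum[OF vs] intro: subsetD[OF conjunct2[OF True] nth_mem]\<close>)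
    moreover have "T (permute_list \<pi> fs) = T fs" if "\<pi> permutes {..<k}" for \<pi>
      using sym that by (metis permute_tensor_def symmetric_tensor_def)
    ultimately have "of_nat (card {\<pi>. \<pi> permutes {..<k}}) * T fs = 0" by simp
    then show ?thesis by (simp add: card_permutations[of _ k])
  qed
qed

lemma symmetric_scale_elementary_replicate:
  "symmetric_tensor k (scale_series c (elementary_tensor smul (replicate k v)))"
  unfolding symmetric_tensor_def
proof safe
  fix \<pi> assume \<pi>: "\<pi> permutes {..<k}"
  have "permute_list (inv \<pi>) (replicate k v) = replicate k v"
    by (rule nth_equalityI) (use permutes_in_image[OF permutes_inv[OF \<pi>]] in
      \<open>auto simp: permute_list_def\<close>)
  then have "permute_tensor \<pi> (elementary_tensor smul (replicate k v))
      = elementary_tensor smul (replicate k v)"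
    using permute_tensor_elementary[of \<pi> "replicate k v" smul] \<pi> by simp
  then show "permute_tensor \<pi> (scale_series c (elementary_tensor smul (replicate k v)))
      = scale_series c (elementary_tensor smul (replicate k v))"
    by (simp add: permute_tensor_def scale_series_def fun_eq_iff)
qed

section \<open>Separating vectors by functionals\<close>

text \<open>Values prescribed on an independent set extend to a linear functional.\<close>

lemma dual_separates:
  assumes "vector_space smul" and "y \<notin> module.span smul {x}"
  obtains f where "f \<in> dual smul" "f x = 0" "f y \<noteq> 0"
proof -
  interpret V: vector_space smul by (rule assms(1))
  interpret P: vector_space_pair smul "(*) :: complex \<Rightarrow> _"
    by unfold_locales (auto simp: algebra_simps)
  have y0: "y \<noteq> 0" using assms(2) V.span_zero by metis
  show ?thesis
  proof (cases "x = 0")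
    case True
    \<comment> \<open>For \<open>x = 0\<close> the set \<open>{y, x}\<close> is dependent, but every
      linear functional vanishes at \<open>x\<close> anyway.\<close>
    have "V.independent {y}" using y0 by simp
    from P.linear_independent_extend[OF this, of "\<lambda>_. 1"]
    obtain g where "Vector_Spaces.linear smul (*) g" "g y = 1" by auto
    then show ?thesis using True that[of g] P.linear_0[of g] by (auto simp: dual_def)
  next
    case False
    then have "V.independent {y, x}" using assms(2) by (simp add: V.independent_insert)
    from P.linear_independent_extend[OF this, of "\<lambda>z. if z = y then 1 else 0"]
    obtain g where "Vector_Spaces.linear smul (*) g" "g y = 1" "g x = (if x = y then 1 else 0)"
      by auto
    moreover have "x \<noteq> y" using assms(2) V.span_base by blast
    ultimately show ?thesis using that[of g] by (auto simp: dual_def)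
  qed
qed

text \<open>Over an infinite field the dual is not covered by finitely many proper subspaces
  \<open>{f. f x = 0}\<close>; the functional is corrected for one new vector at a time.\<close>

lemma dual_nonvanishing:
  assumes "vector_space smul" and "finite X" and "0 \<notin> X"
  obtains f where "f \<in> dual smul" "\<forall>x\<in>X. f x \<noteq> 0"
proof -
  interpret V: vector_space smul by (rule assms(1))
  interpret P: vector_space_pair smul "(*) :: complex \<Rightarrow> _"
    by unfold_locales (auto simp: algebra_simps)
  have "\<exists>f\<in>dual smul. \<forall>x\<in>X. f x \<noteq> 0"
    using assms(2,3)
  proof (induction X rule: finite_induct)
    case empty
    show ?case using P.linear_zero by (auto simp: dual_def)
  next
    case (insert y X)
    then obtain f where f: "f \<in> dual smul" "\<forall>x\<in>X. f x \<noteq> 0" by auto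
    have "y \<notin> V.span {0}" using insert by auto
    then obtain g where g: "g \<in> dual smul" "g y \<noteq> 0"
      using dual_separates[OF assms(1)] by metis
    \<comment> \<open>\<open>g + t f\<close> works unless \<open>t\<close> is one of finitely many quotients.\<close>
    have "finite ((\<lambda>x. - g x / f x) ` insert y X)" using insert by simp
    then obtain t where t: "t \<notin> (\<lambda>x. - g x / f x) ` insert y X"
      using ex_new_if_finite[OF infinite_UNIV_char_0] by blast
    have "g x + t * f x \<noteq> 0" if "x \<in> insert y X" for x
    \<comment> \<open>Within \<open>insert y X\<close>, \<open>f\<close> can vanish only at the new
      vector \<open>y\<close>, where \<open>g\<close> does not; there every \<open>t\<close> works,
      and the quotient by 0 merely excludes one more value.\<close>
    proof (cases "f x = 0")
      case True
      then show ?thesis using that f(2) g(2) by auto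
    next
      case False
      have "t \<noteq> - g x / f x" using t that by blast
      then have "t * f x \<noteq> - g x" using False by (metis nonzero_eq_divide_eq)
      then show ?thesis unfolding add_eq_0_iff .
    qed
    moreover have "(\<lambda>x. g x + t * f x) \<in> dual smul"
      using f(1) g(1) P.linear_compose_add P.linear_compose_scale_right by (simp add: dual_def)
    ultimately show ?case by (intro bexI[of _ "\<lambda>x. g x + t * f x"] ballI)
  qed
  then show ?thesis using that by blast
qed

section \<open>Rank one versus symmetry for signature tensors\<close>

theorem theorem7p1:
  fixes smul :: "complex \<Rightarrow> 'v::ab_group_add \<Rightarrow> 'v"
    and B :: "'v set" and d k :: nat and T :: "'v series"
  assumes "finite_dimensional_vector_space smul B"
    and "vector_space.dim smul UNIV = d"
    and "k \<ge> 1"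
    and "T \<in> signature_variety smul k"
    and "T \<noteq> 0"
  shows "tensor_rank smul k T = 1 \<longleftrightarrow> symmetric_tensor k T"
proof -
  interpret V: finite_dimensional_vector_space smul B by (rule assms(1))
  have vs: "vector_space smul" by (rule V.vector_space_axioms)
  have T: "T \<in> tensor_power smul k" using assms(4) signature_variety_subset by blast
  obtain v where diag: "\<And>f. f \<in> dual smul \<Longrightarrow> T (replicate k f) = f v ^ k / fact k"
    using signature_variety_diagonal[OF vs assms(4)] by blast
  have lin: "f (smul c x) = c * f x" if "f \<in> dual smul" for f c x
    using that by (simp add: dual_def Vector_Spaces.linear_iff)
  have lin0: "f 0 = 0" if "f \<in> dual smul" for f using lin[OF that, of 0 0] by simp
  have "\<exists>ws. length ws = k \<and> T = elementary_tensor smul ws" if sym: "symmetric_tensor k T"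
  proof -
    \<comment> \<open>A symmetric tensor with the same diagonal values as \<open>T\<close>.\<close>
    let ?E = "scale_series (1 / fact k) (elementary_tensor smul (replicate k v))"
    have "T - ?E = 0"
    proof (rule symmetric_tensor_eq_0[OF vs])
      show "T - ?E \<in> tensor_power smul k"
        by (intro series.subspace_diff series.subspace_scale subspace_tensor_power T
            elementary_tensor_in_tensor_power) simp
      show "symmetric_tensor k (T - ?E)"
        using sym symmetric_scale_elementary_replicate[of k "1 / fact k" smul v]
        by (simp add: symmetric_tensor_def permute_tensor_def fun_eq_iff)
      show "(T - ?E) (replicate k f) = 0" if "f \<in> dual smul" for f
        using that by (auto simp: diag scale_series_def elementary_tensor_def set_replicate_conv_if split: if_splits)
    qed
    then have "T = ?E" by simp
    \<comment> \<open>Exposing a first factor lets it absorb \<open>1 / fact k\<close>, so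
      \<open>T\<close> is itself elementary.\<close>
    also have "replicate k v = v # replicate (k - 1) v"
      using assms(3) by (cases k) auto
    finally have "T = elementary_tensor smul (smul (1 / fact k) v # replicate (k - 1) v)"
      by (simp only: scale_elementary_tensor[OF vs])
    then show ?thesis using assms(3)
      by (metis Suc_pred' length_Cons length_replicate less_eq_Suc_le One_nat_def)
  qed
  moreover have "symmetric_tensor k T"
    if ws: "length ws = k" and Tws: "T = elementary_tensor smul ws" for ws
  proof -
    \<comment> \<open>A product of linear forms in \<open>f\<close> equals, up to a constant, a
      power of the single form given by \<open>v\<close>.\<close>
    have prod: "(\<Prod>i<k. f (ws ! i)) = f v ^ k / fact k" if "f \<in> dual smul" for f
      using diag[OF that] that ws Tws by (auto simp: elementary_tensor_def split: if_splits)
    have ws0: "0 \<notin> set ws"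
    proof
      assume "0 \<in> set ws"
      then obtain i where i: "i < k" "ws ! i = 0" using ws by (auto simp: in_set_conv_nth)
      have "T fs = 0" for fs
      proof (cases "length fs = k \<and> set fs \<subseteq> dual smul")
        case True
        then have "(fs ! i) (ws ! i) = 0" using i lin0 by (metis nth_mem subsetD)
        then have "(\<Prod>j<k. (fs ! j) (ws ! j)) = 0" using i(1) by (intro prod_zero) auto
        then show ?thesis using ws by (simp add: Tws elementary_tensor_def)
      qed (auto simp: Tws ws elementary_tensor_def)
      then show False using assms(5) by (auto simp: fun_eq_iff)
    qed
    obtain f where f: "f \<in> dual smul" "\<forall>x\<in>set ws. f x \<noteq> 0"
      using dual_nonvanishing[OF vs _ ws0] by blast
    have "f v \<noteq> 0"
    proof
      assume "f v = 0"
      \<comment> \<open>Here \<open>0 ^ k = 0\<close> relies on \<open>k \<ge> 1\<close>.\<close>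
      then have "(\<Prod>i<k. f (ws ! i)) = 0" using prod[OF f(1)] assms(3) by simp
      then show False using f(2) ws by (auto simp: prod_zero_iff)
    qed
    then have v0: "v \<noteq> 0" using lin0[OF f(1)] by auto
    have "\<exists>c. ws ! i = smul c v" if i: "i < k" for i
    proof -
      \<comment> \<open>A functional that kills \<open>ws ! i\<close> kills the whole product, hence
        \<open>v\<close>. The proportionality obtained can be reversed because
        \<open>v \<noteq> 0\<close>.\<close>
      have "v \<in> V.span {ws ! i}"
      proof (rule ccontr)
        assume "v \<notin> V.span {ws ! i}"
        then obtain g where g: "g \<in> dual smul" "g (ws ! i) = 0" "g v \<noteq> 0"
          using dual_separates[OF vs] by blast
        have "(\<Prod>i<k. g (ws ! i)) = 0" using g(2) i by (auto simp: prod_zero_iff)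
        then show False using prod[OF g(1)] g(3) by simp
      qed
      then obtain c where c: "v = smul c (ws ! i)" by (auto simp: V.span_singleton)
      then have "c \<noteq> 0" using v0 by auto
      then have "ws ! i = smul (1 / c) v" using c by simp
      then show ?thesis by blast
    qed
    then obtain c where c: "\<And>i. i < k \<Longrightarrow> ws ! i = smul (c i) v" by metis
    \<comment> \<open>Multilinearity collects the scalars, leaving a multiple of a tensor with equal
      factors.\<close>
    have "T = scale_series (\<Prod>i<k. c i) (elementary_tensor smul (replicate k v))"
    proof
      fix fs
      have "(\<Prod>i<k. (fs ! i) (ws ! i)) = (\<Prod>i<k. c i * (fs ! i) v)"
        if "length fs = k" "set fs \<subseteq> dual smul"
        by (rule prod.cong) (use that c lin in \<open>auto simp: subset_iff\<close>)
      then show "T fs = scale_series (\<Prod>i<k. c i) (elementary_tensor smul (replicate k v)) fs"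
        by (auto simp: Tws ws scale_series_def elementary_tensor_def prod.distrib)
    qed
    then show ?thesis using symmetric_scale_elementary_replicate by metis
  qed
  ultimately show ?thesis using tensor_rank_eq_1_iff[OF vs assms(3) T assms(5)] by blast
qed

end
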